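(* Let $K$ be a field, let $E=(E^0,E^1,r,s)$ be a row-finite graph without sinks, and let $(X,\{R_e\}_{e\in E^1},\{D_v\}_{v\in E^0},\{f_e\}_{e\in E^1})$ be an $E$-algebraic branching system. Suppose that for each finite set of closed paths $\{\alpha^1,\dots,\alpha^n\}$ in $E$, beginning on the same vertex $v$, there is an element $z_0\in D_v$ such that $f_{\alpha^i}(z_0)\neq z_0$ for all $i\in\{1,\dots,n\}$. Then the representation $\pi:L_K(E)\to\mathrm{Hom}_K(M)$ of $L_K(E)$ induced by this $E$-algebraic branching system is faithful.
   Context: A graph $E=(E^0,E^1,r,s)$ is a directed graph with countable vertex set $E^0$, countable edge set $E^1$, and range and source maps $r,s:E^1\to E^0$. It is row-finite if $s^{-1}(v)$ is finite for each $v\in E^0$; a sink is a vertex which emits no edges. The Leavitt path algebra $L_K(E)$ is the universal $K$-algebra generated by a set $\{v:v\in E^0\}$ of pairwise orthogonal idempotents together with a set $\{e,e^*:e\in E^1\}$ of elements satisfying: (1) $s(e)e=er(e)=e$ for all $e\in E^1$; (2) $r(e)e^*=e^*s(e)=e^*$ for all $e\in E^1$; (3) $e^*f=\delta_{e,f}r(e)$ for all $e,f\in E^1$; (4) $v=\sum_{e:s(e)=v}ee^*$ for every vertex $v$ with $0<\#\{e:s(e)=v\}<\infty$. An $E$-algebraic branching system consists of a set $X$, families $\{R_e\}_{e\in E^1}$, $\{D_v\}_{v\in E^0}$ of subsets of $X$, and maps $\{f_e\}_{e\in E^1}$ such that: (1) $R_e\cap R_d=\emptyset$ for $d\neq e$;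 (2) $D_u\cap D_v=\emptyset$ for $u\ne v$; (3) $R_e\subseteq D_{s(e)}$ for each $e\in E^1$; (4) $D_v=\bigcup_{e:s(e)=v}R_e$ if $0<\#\{e:s(e)=v\}<\infty$; (5) for each $e\in E^1$, $f_e:D_{r(e)}\to R_e$ is a bijection. Induced representation: $M$ is the $K$-module of all functions $X\to K$, $\mathrm{Hom}_K(M)$ is the $K$-algebra of all $K$-module homomorphisms $M\to M$ (multiplication is composition), and $\pi$ is the $K$-algebra homomorphism determined by: $\pi(e)(\phi)(x)=\phi(f_e^{-1}(x))$ if $x\in R_e$ and $0$ otherwise; $\pi(e^* )(\phi)(x)=\phi(f_e(x))$ if $x\in D_{r(e)}$ and $0$ otherwise; $\pi(v)(\phi)(x)=\phi(x)$ if $x\in D_v$ and $0$ otherwise. Faithful means injective. A closed path beginning on $v$ is a sequence of edges $\alpha=e_1\dots e_n$ with $r(e_i)=s(e_{i+1})$ for $1\le i\le n-1$ and $s(e_1)=r(e_n)=v$. For such $\alpha$, $f_\alpha:D_v\to R_{e_1}\subseteq D_v$ denotes the composition $f_\alpha=f_{e_1}\circ\cdots\circ f_{e_n}$. *)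

theory Defs
  imports
    "HOL-Library.FuncSet"
    "HOL-Library.Countable_Set"
    "Graph_Theory.Digraph"
    "Graph_Theory.Arc_Walk"
begin

section \<open>Associative algebras over a field, not necessarily unital\<close>

record ('k, 'a) k_algebra =
  carrier :: "'a set"
  zero :: 'a
  add :: "'a \<Rightarrow> 'a \<Rightarrow> 'a"
  smul :: "'k \<Rightarrow> 'a \<Rightarrow> 'a"
  mul :: "'a \<Rightarrow> 'a \<Rightarrow> 'a"

locale k_algebra =
  fixes A :: "('k :: field, 'a) k_algebra"
  assumes zero_closed: "zero A \<in> carrier A"
    and add_closed: "\<lbrakk>a \<in> carrier A; b \<in> carrier A\<rbrakk> \<Longrightarrow> add A a b \<in> carrier A"
    and smul_closed: "a \<in> carrier A \<Longrightarrow> smul A c a \<in> carrier A"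
    and mul_closed: "\<lbrakk>a \<in> carrier A; b \<in> carrier A\<rbrakk> \<Longrightarrow> mul A a b \<in> carrier A"
    and add_assoc: "\<lbrakk>a \<in> carrier A; b \<in> carrier A; z \<in> carrier A\<rbrakk> \<Longrightarrow>
          add A (add A a b) z = add A a (add A b z)"
    and add_comm: "\<lbrakk>a \<in> carrier A; b \<in> carrier A\<rbrakk> \<Longrightarrow> add A a b = add A b a"
    and add_zero: "a \<in> carrier A \<Longrightarrow> add A a (zero A) = a"
    and add_inverse: "a \<in> carrier A \<Longrightarrow> add A a (smul A (- 1) a) = zero A"
    and smul_add: "\<lbrakk>a \<in> carrier A; b \<in> carrier A\<rbrakk> \<Longrightarrow>
          smul A c (add A a b) = add A (smul A c a) (smul A c b)"
    and add_smul: "a \<in> carrier A \<Longrightarrow> smul A (c + d) a = add A (smul A c a) (smul A d a)"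
    and smul_smul: "a \<in> carrier A \<Longrightarrow> smul A c (smul A d a) = smul A (c * d) a"
    and smul_one: "a \<in> carrier A \<Longrightarrow> smul A 1 a = a"
    and mul_assoc: "\<lbrakk>a \<in> carrier A; b \<in> carrier A; z \<in> carrier A\<rbrakk> \<Longrightarrow>
          mul A (mul A a b) z = mul A a (mul A b z)"
    and add_mul: "\<lbrakk>a \<in> carrier A; b \<in> carrier A; z \<in> carrier A\<rbrakk> \<Longrightarrow>
          mul A (add A a b) z = add A (mul A a z) (mul A b z)"
    and mul_add: "\<lbrakk>a \<in> carrier A; b \<in> carrier A; z \<in> carrier A\<rbrakk> \<Longrightarrow>
          mul A a (add A b z) = add A (mul A a b) (mul A a z)"
    and smul_mul: "\<lbrakk>a \<in> carrier A; b \<in> carrier A\<rbrakk> \<Longrightarrow>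
          mul A (smul A c a) b = smul A c (mul A a b)"
    and mul_smul: "\<lbrakk>a \<in> carrier A; b \<in> carrier A\<rbrakk> \<Longrightarrow>
          mul A a (smul A c b) = smul A c (mul A a b)"

definition alg_hom ::
  "('k :: field, 'a) k_algebra \<Rightarrow> ('k, 'b) k_algebra \<Rightarrow> ('a \<Rightarrow> 'b) \<Rightarrow> bool" where
  "alg_hom A B h \<longleftrightarrow>
     h ` carrier A \<subseteq> carrier B \<and>
     (\<forall>a\<in>carrier A. \<forall>b\<in>carrier A. h (add A a b) = add B (h a) (h b)) \<and>
     (\<forall>c. \<forall>a\<in>carrier A. h (smul A c a) = smul B c (h a)) \<and>
     (\<forall>a\<in>carrier A. \<forall>b\<in>carrier A. h (mul A a b) = mul B (h a) (h b))"

section \<open>The universal algebra on generators and relations\<close>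

datatype (gens: 'g, dead 'k) alg_term =
    Gen 'g
  | Zero
  | Add "('g, 'k) alg_term" "('g, 'k) alg_term"
  | Scale 'k "('g, 'k) alg_term"
  | Mul "('g, 'k) alg_term" "('g, 'k) alg_term"

definition alg_terms :: "'g set \<Rightarrow> ('g, 'k) alg_term set" where
  "alg_terms G = {t. gens t \<subseteq> G}"

text \<open>
  The least congruence on the terms over \<open>G\<close> that contains the relations \<open>Rel\<close> and makes the
  quotient an associative algebra over the field. No unit is adjoined.
\<close>

inductive_set pres_cong ::
  "'g set \<Rightarrow> (('g, 'k :: field) alg_term \<times> ('g, 'k) alg_term) set \<Rightarrow>
   (('g, 'k) alg_term \<times> ('g, 'k) alg_term) set"
  for G :: "'g set" and Rel :: "(('g, 'k) alg_term \<times> ('g, 'k) alg_term) set"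
where
  rel: "\<lbrakk>(a, b) \<in> Rel; a \<in> alg_terms G; b \<in> alg_terms G\<rbrakk> \<Longrightarrow> (a, b) \<in> pres_cong G Rel"
| refl: "a \<in> alg_terms G \<Longrightarrow> (a, a) \<in> pres_cong G Rel"
| sym: "(a, b) \<in> pres_cong G Rel \<Longrightarrow> (b, a) \<in> pres_cong G Rel"
| trans: "\<lbrakk>(a, b) \<in> pres_cong G Rel; (b, z) \<in> pres_cong G Rel\<rbrakk> \<Longrightarrow> (a, z) \<in> pres_cong G Rel"
| cong_Add: "\<lbrakk>(a, a') \<in> pres_cong G Rel; (b, b') \<in> pres_cong G Rel\<rbrakk> \<Longrightarrow>
    (Add a b, Add a' b') \<in> pres_cong G Rel"
| cong_Scale: "(a, a') \<in> pres_cong G Rel \<Longrightarrow> (Scale c a, Scale c a') \<in> pres_cong G Rel"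
| cong_Mul: "\<lbrakk>(a, a') \<in> pres_cong G Rel; (b, b') \<in> pres_cong G Rel\<rbrakk> \<Longrightarrow>
    (Mul a b, Mul a' b') \<in> pres_cong G Rel"
| Add_assoc: "\<lbrakk>a \<in> alg_terms G; b \<in> alg_terms G; z \<in> alg_terms G\<rbrakk> \<Longrightarrow>
    (Add (Add a b) z, Add a (Add b z)) \<in> pres_cong G Rel"
| Add_comm: "\<lbrakk>a \<in> alg_terms G; b \<in> alg_terms G\<rbrakk> \<Longrightarrow> (Add a b, Add b a) \<in> pres_cong G Rel"
| Add_Zero: "a \<in> alg_terms G \<Longrightarrow> (Add a Zero, a) \<in> pres_cong G Rel"
| Add_inverse: "a \<in> alg_terms G \<Longrightarrow> (Add a (Scale (- 1) a), Zero) \<in> pres_cong G Rel"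
| Scale_Add: "\<lbrakk>a \<in> alg_terms G; b \<in> alg_terms G\<rbrakk> \<Longrightarrow>
    (Scale c (Add a b), Add (Scale c a) (Scale c b)) \<in> pres_cong G Rel"
| Add_Scale: "a \<in> alg_terms G \<Longrightarrow>
    (Scale (c + d) a, Add (Scale c a) (Scale d a)) \<in> pres_cong G Rel"
| Scale_Scale: "a \<in> alg_terms G \<Longrightarrow> (Scale c (Scale d a), Scale (c * d) a) \<in> pres_cong G Rel"
| Scale_one: "a \<in> alg_terms G \<Longrightarrow> (Scale 1 a, a) \<in> pres_cong G Rel"
| Mul_assoc: "\<lbrakk>a \<in> alg_terms G; b \<in> alg_terms G; z \<in> alg_terms G\<rbrakk> \<Longrightarrow>
    (Mul (Mul a b) z, Mul a (Mul b z)) \<in> pres_cong G Rel"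
| Add_Mul: "\<lbrakk>a \<in> alg_terms G; b \<in> alg_terms G; z \<in> alg_terms G\<rbrakk> \<Longrightarrow>
    (Mul (Add a b) z, Add (Mul a z) (Mul b z)) \<in> pres_cong G Rel"
| Mul_Add: "\<lbrakk>a \<in> alg_terms G; b \<in> alg_terms G; z \<in> alg_terms G\<rbrakk> \<Longrightarrow>
    (Mul a (Add b z), Add (Mul a b) (Mul a z)) \<in> pres_cong G Rel"
| Scale_Mul: "\<lbrakk>a \<in> alg_terms G; b \<in> alg_terms G\<rbrakk> \<Longrightarrow>
    (Mul (Scale c a) b, Scale c (Mul a b)) \<in> pres_cong G Rel"
| Mul_Scale: "\<lbrakk>a \<in> alg_terms G; b \<in> alg_terms G\<rbrakk> \<Longrightarrow>
    (Mul a (Scale c b), Scale c (Mul a b)) \<in> pres_cong G Rel"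

definition presented_algebra ::
  "'g set \<Rightarrow> (('g, 'k :: field) alg_term \<times> ('g, 'k) alg_term) set \<Rightarrow>
   ('k, ('g, 'k) alg_term set) k_algebra" where
  "presented_algebra G Rel =
     \<lparr> carrier = alg_terms G // pres_cong G Rel,
       zero = pres_cong G Rel `` {Zero},
       add = (\<lambda>C D. \<Union>a\<in>C. \<Union>b\<in>D. pres_cong G Rel `` {Add a b}),
       smul = (\<lambda>c C. \<Union>a\<in>C. pres_cong G Rel `` {Scale c a}),
       mul = (\<lambda>C D. \<Union>a\<in>C. \<Union>b\<in>D. pres_cong G Rel `` {Mul a b}) \<rparr>"

primrec eval_term :: "('k, 'a) k_algebra \<Rightarrow> ('g \<Rightarrow> 'a) \<Rightarrow> ('g, 'k) alg_term \<Rightarrow> 'a" where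
  "eval_term A g (Gen x) = g x"
| "eval_term A g Zero = zero A"
| "eval_term A g (Add s t) = add A (eval_term A g s) (eval_term A g t)"
| "eval_term A g (Scale c t) = smul A c (eval_term A g t)"
| "eval_term A g (Mul s t) = mul A (eval_term A g s) (eval_term A g t)"

text \<open>
  The map out of a presented algebra determined by the images \<open>g\<close> of the generators. The set
  \<open>eval_term A g ` C\<close> is a singleton whenever \<open>g\<close> satisfies the relations
  (lemma \<open>presented_lift_class\<close>).
\<close>

definition presented_lift ::
  "('k, 'a) k_algebra \<Rightarrow> ('g \<Rightarrow> 'a) \<Rightarrow> ('g, 'k) alg_term set \<Rightarrow> 'a" where
  "presented_lift A g C = the_elem (eval_term A g ` C)"

lemma alg_terms_simps [simp]:
  "Gen x \<in> alg_terms G \<longleftrightarrow> x \<in> G"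
  "Zero \<in> alg_terms G"
  "Add s t \<in> alg_terms G \<longleftrightarrow> s \<in> alg_terms G \<and> t \<in> alg_terms G"
  "Scale c t \<in> alg_terms G \<longleftrightarrow> t \<in> alg_terms G"
  "Mul s t \<in> alg_terms G \<longleftrightarrow> s \<in> alg_terms G \<and> t \<in> alg_terms G"
  by (auto simp: alg_terms_def)

lemma pres_cong_terms:
  "(a, b) \<in> pres_cong G Rel \<Longrightarrow> a \<in> alg_terms G \<and> b \<in> alg_terms G"
  by (induction rule: pres_cong.induct) auto

lemma equiv_pres_cong: "equiv (alg_terms G) (pres_cong G Rel)"
proof (rule equivI)
  show "pres_cong G Rel \<subseteq> alg_terms G \<times> alg_terms G"
    using pres_cong_terms by fast
  show "refl_on (alg_terms G) (pres_cong G Rel)"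
    unfolding refl_on_def by (auto intro: pres_cong.refl)
  show "sym (pres_cong G Rel)"
    unfolding sym_def by (blast intro: pres_cong.sym)
  show "trans (pres_cong G Rel)"
    unfolding trans_def by (blast intro: pres_cong.trans)
qed

lemma pres_cong_class_eq:
  "(a, b) \<in> pres_cong G Rel \<Longrightarrow> pres_cong G Rel `` {a} = pres_cong G Rel `` {b}"
  using equiv_class_eq[OF equiv_pres_cong] by fast

lemma UN_const_on: "\<lbrakk>c \<in> C; \<And>x. x \<in> C \<Longrightarrow> F x = K\<rbrakk> \<Longrightarrow> (\<Union>x\<in>C. F x) = K"
  by (metis SUP_eq_const empty_iff)

lemma add_class:
  assumes "a \<in> alg_terms G" "b \<in> alg_terms G"
  shows "add (presented_algebra G Rel) (pres_cong G Rel `` {a}) (pres_cong G Rel `` {b})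
    = pres_cong G Rel `` {Add a b}"
  unfolding presented_algebra_def
  by (simp, rule UN_const_on[of a], simp add: pres_cong.refl assms,
      rule UN_const_on[of b], simp add: pres_cong.refl assms)
    (auto intro!: pres_cong_class_eq[symmetric] pres_cong.cong_Add)

lemma mul_class:
  assumes "a \<in> alg_terms G" "b \<in> alg_terms G"
  shows "mul (presented_algebra G Rel) (pres_cong G Rel `` {a}) (pres_cong G Rel `` {b})
    = pres_cong G Rel `` {Mul a b}"
  unfolding presented_algebra_def
  by (simp, rule UN_const_on[of a], simp add: pres_cong.refl assms,
      rule UN_const_on[of b], simp add: pres_cong.refl assms)
    (auto intro!: pres_cong_class_eq[symmetric] pres_cong.cong_Mul)

lemma smul_class:
  assumes "a \<in> alg_terms G"
  shows "smul (presented_algebra G Rel) c (pres_cong G Rel `` {a})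
    = pres_cong G Rel `` {Scale c a}"
  unfolding presented_algebra_def
  by (simp, rule UN_const_on[of a], simp add: pres_cong.refl assms)
    (auto intro!: pres_cong_class_eq[symmetric] pres_cong.cong_Scale)

lemma zero_class: "zero (presented_algebra G Rel) = pres_cong G Rel `` {Zero}"
  by (simp add: presented_algebra_def)

lemma carrier_presentedI:
  "a \<in> alg_terms G \<Longrightarrow> pres_cong G Rel `` {a} \<in> carrier (presented_algebra G Rel)"
  by (simp add: presented_algebra_def quotientI)

lemma carrier_presentedE:
  assumes "C \<in> carrier (presented_algebra G Rel)"
  obtains a where "a \<in> alg_terms G" "C = pres_cong G Rel `` {a}"
  using assms by (auto simp: presented_algebra_def elim: quotientE)

lemma k_algebra_presented: "k_algebra (presented_algebra G Rel)"
proof -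
  note eqI = pres_cong_class_eq[OF pres_cong.Add_assoc] pres_cong_class_eq[OF pres_cong.Add_comm]
    pres_cong_class_eq[OF pres_cong.Add_Zero] pres_cong_class_eq[OF pres_cong.Add_inverse]
    pres_cong_class_eq[OF pres_cong.Scale_Add] pres_cong_class_eq[OF pres_cong.Add_Scale]
    pres_cong_class_eq[OF pres_cong.Scale_Scale] pres_cong_class_eq[OF pres_cong.Scale_one]
    pres_cong_class_eq[OF pres_cong.Mul_assoc] pres_cong_class_eq[OF pres_cong.Add_Mul]
    pres_cong_class_eq[OF pres_cong.Mul_Add] pres_cong_class_eq[OF pres_cong.Scale_Mul]
    pres_cong_class_eq[OF pres_cong.Mul_Scale]
  show ?thesis
    by unfold_locales
      ((elim carrier_presentedE)?;
        simp add: add_class mul_class smul_class zero_class carrier_presentedI;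
        rule eqI; simp)+
qed

lemma eval_term_closed:
  assumes "k_algebra A" "\<And>x. x \<in> G \<Longrightarrow> g x \<in> carrier A" "t \<in> alg_terms G"
  shows "eval_term A g t \<in> carrier A"
  using assms(3)
  by (induction t)
    (use assms(1,2) in \<open>auto intro: k_algebra.zero_closed k_algebra.add_closed
      k_algebra.smul_closed k_algebra.mul_closed\<close>)

lemma eval_term_cong:
  assumes A: "k_algebra A"
    and g: "\<And>x. x \<in> G \<Longrightarrow> g x \<in> carrier A"
    and Rel: "\<And>a b. (a, b) \<in> Rel \<Longrightarrow> eval_term A g a = eval_term A g b"
    and ab: "(a, b) \<in> pres_cong G Rel"
  shows "eval_term A g a = eval_term A g b"
proof -
  interpret k_algebra A by (rule A)
  note [simp] = eval_term_closed[OF A g]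
  from ab show ?thesis
    by (induction rule: pres_cong.induct)
      (simp_all add: Rel add_assoc add_zero add_inverse smul_add add_smul smul_smul smul_one
        mul_assoc add_mul mul_add smul_mul mul_smul add_comm)
qed

lemma presented_lift_class:
  assumes "k_algebra A" "\<And>x. x \<in> G \<Longrightarrow> g x \<in> carrier A"
    and "\<And>a b. (a, b) \<in> Rel \<Longrightarrow> eval_term A g a = eval_term A g b"
    and "t \<in> alg_terms G"
  shows "presented_lift A g (pres_cong G Rel `` {t}) = eval_term A g t"
proof -
  have "eval_term A g ` (pres_cong G Rel `` {t}) = {eval_term A g t}"
  proof
    show "eval_term A g ` (pres_cong G Rel `` {t}) \<subseteq> {eval_term A g t}"
    proof
      fix y assume "y \<in> eval_term A g ` (pres_cong G Rel `` {t})"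
      then obtain s where "(t, s) \<in> pres_cong G Rel" "y = eval_term A g s" by auto
      then show "y \<in> {eval_term A g t}"
        using eval_term_cong[of A G g Rel t s] assms by auto
    qed
    show "{eval_term A g t} \<subseteq> eval_term A g ` (pres_cong G Rel `` {t})"
      using pres_cong.refl[OF assms(4)] by auto
  qed
  then show ?thesis by (simp add: presented_lift_def)
qed

theorem presented_algebra_universal:
  assumes A: "k_algebra A"
    and g: "\<And>x. x \<in> G \<Longrightarrow> g x \<in> carrier A"
    and Rel: "\<And>a b. (a, b) \<in> Rel \<Longrightarrow> eval_term A g a = eval_term A g b"
  shows "alg_hom (presented_algebra G Rel) A (presented_lift A g)"
    and "\<And>x. x \<in> G \<Longrightarrow> presented_lift A g (pres_cong G Rel `` {Gen x}) = g x"
    and "\<And>h C. \<lbrakk>alg_hom (presented_algebra G Rel) A h;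
            \<And>x. x \<in> G \<Longrightarrow> h (pres_cong G Rel `` {Gen x}) = g x;
            C \<in> carrier (presented_algebra G Rel)\<rbrakk> \<Longrightarrow> h C = presented_lift A g C"
proof -
  note lift = presented_lift_class[OF A g Rel]
  show "alg_hom (presented_algebra G Rel) A (presented_lift A g)"
    unfolding alg_hom_def
    by (auto elim!: carrier_presentedE simp: add_class mul_class smul_class lift
        intro: eval_term_closed[OF A g])
  show "presented_lift A g (pres_cong G Rel `` {Gen x}) = g x" if "x \<in> G" for x
    using that by (simp add: lift)
  show "h C = presented_lift A g C"
    if h: "alg_hom (presented_algebra G Rel) A h"
      and hg: "\<And>x. x \<in> G \<Longrightarrow> h (pres_cong G Rel `` {Gen x}) = g x"
      and C: "C \<in> carrier (presented_algebra G Rel)" for h C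
  proof -
    let ?P = "presented_algebra G Rel" and ?cl = "\<lambda>t. pres_cong G Rel `` {t}"
    interpret P: k_algebra ?P by (rule k_algebra_presented)
    interpret A: k_algebra A by (rule A)
    have hadd: "h (add ?P a b) = add A (h a) (h b)"
      and hmul: "h (mul ?P a b) = mul A (h a) (h b)"
      if "a \<in> carrier ?P" "b \<in> carrier ?P" for a b
      using h that by (auto simp: alg_hom_def)
    have hsmul: "h (smul ?P c a) = smul A c (h a)" and hcl: "h a \<in> carrier A"
      if "a \<in> carrier ?P" for a c
      using h that by (auto simp: alg_hom_def)
    have "h (zero ?P) = h (add ?P (zero ?P) (smul ?P (- 1) (zero ?P)))"
      by (simp add: P.add_inverse P.zero_closed)
    also have "\<dots> = zero A"
      by (simp add: hadd hsmul P.zero_closed P.smul_closed A.add_inverse hcl)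
    finally have hzero: "h (?cl Zero) = zero A" by (simp add: zero_class)
    have "h (?cl t) = eval_term A g t" if "t \<in> alg_terms G" for t
      using that
    proof (induction t)
      case (Scale c t)
      then have "h (smul ?P c (?cl t)) = smul A c (h (?cl t))"
        by (simp add: hsmul carrier_presentedI)
      with Scale show ?case by (simp add: smul_class)
    next
      case (Add s t)
      then have "h (add ?P (?cl s) (?cl t)) = add A (h (?cl s)) (h (?cl t))"
        by (simp add: hadd carrier_presentedI)
      with Add show ?case by (simp add: add_class)
    next
      case (Mul s t)
      then have "h (mul ?P (?cl s) (?cl t)) = mul A (h (?cl s)) (h (?cl t))"
        by (simp add: hmul carrier_presentedI)
      with Mul show ?case by (simp add: mul_class)
    qed (simp_all add: hg hzero)
    with C show ?thesis by (auto elim!: carrier_presentedE simp: lift)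
  qed
qed

section \<open>Graphs and Leavitt path algebras\<close>

text \<open>The source map \<open>s\<close> is \<open>tail\<close> and the range map \<open>r\<close> is \<open>head\<close>.\<close>

locale countable_digraph = wf_digraph E for E :: "('v, 'e) pre_digraph" +
  assumes countable_verts: "countable (verts E)"
    and countable_arcs: "countable (arcs E)"

definition row_finite :: "('v, 'e) pre_digraph \<Rightarrow> bool" where
  "row_finite E \<longleftrightarrow> (\<forall>v\<in>verts E. finite (out_arcs E v))"

definition is_sink :: "('v, 'e) pre_digraph \<Rightarrow> 'v \<Rightarrow> bool" where
  "is_sink E v \<longleftrightarrow> v \<in> verts E \<and> out_arcs E v = {}"

datatype ('v, 'e) lpa_gen = Vertex 'v | Edge 'e | Ghost 'e

definition lpa_gens :: "('v, 'e) pre_digraph \<Rightarrow> ('v, 'e) lpa_gen set" where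
  "lpa_gens E = Vertex ` verts E \<union> Edge ` arcs E \<union> Ghost ` arcs E"

text \<open>
  In \<open>CK2\<close> the finite sum is written once for every enumeration \<open>es\<close> of the edges emitted
  by \<open>v\<close>; these relations coincide because addition is commutative. An infinite emitter has no
  enumeration, and \<open>es \<noteq> []\<close> excludes sinks.
\<close>

inductive_set lpa_rels ::
  "('v, 'e) pre_digraph \<Rightarrow>
   ((('v, 'e) lpa_gen, 'k :: field) alg_term \<times> (('v, 'e) lpa_gen, 'k) alg_term) set"
  for E :: "('v, 'e) pre_digraph"
where
  idem: "v \<in> verts E \<Longrightarrow> (Mul (Gen (Vertex v)) (Gen (Vertex v)), Gen (Vertex v)) \<in> lpa_rels E"
| orth: "\<lbrakk>v \<in> verts E; w \<in> verts E; v \<noteq> w\<rbrakk> \<Longrightarrow>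
    (Mul (Gen (Vertex v)) (Gen (Vertex w)), Zero) \<in> lpa_rels E"
| source_edge: "e \<in> arcs E \<Longrightarrow>
    (Mul (Gen (Vertex (tail E e))) (Gen (Edge e)), Gen (Edge e)) \<in> lpa_rels E"
| edge_range: "e \<in> arcs E \<Longrightarrow>
    (Mul (Gen (Edge e)) (Gen (Vertex (head E e))), Gen (Edge e)) \<in> lpa_rels E"
| range_ghost: "e \<in> arcs E \<Longrightarrow>
    (Mul (Gen (Vertex (head E e))) (Gen (Ghost e)), Gen (Ghost e)) \<in> lpa_rels E"
| ghost_source: "e \<in> arcs E \<Longrightarrow>
    (Mul (Gen (Ghost e)) (Gen (Vertex (tail E e))), Gen (Ghost e)) \<in> lpa_rels E"
| CK1_same: "e \<in> arcs E \<Longrightarrow>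
    (Mul (Gen (Ghost e)) (Gen (Edge e)), Gen (Vertex (head E e))) \<in> lpa_rels E"
| CK1_diff: "\<lbrakk>e \<in> arcs E; d \<in> arcs E; e \<noteq> d\<rbrakk> \<Longrightarrow>
    (Mul (Gen (Ghost e)) (Gen (Edge d)), Zero) \<in> lpa_rels E"
| CK2: "\<lbrakk>v \<in> verts E; distinct es; set es = out_arcs E v; es \<noteq> []\<rbrakk> \<Longrightarrow>
    (Gen (Vertex v), foldr Add (map (\<lambda>e. Mul (Gen (Edge e)) (Gen (Ghost e))) es) Zero)
      \<in> lpa_rels E"

definition leavitt_path_algebra ::
  "('v, 'e) pre_digraph \<Rightarrow> ('k :: field, (('v, 'e) lpa_gen, 'k) alg_term set) k_algebra" where
  "leavitt_path_algebra E = presented_algebra (lpa_gens E) (lpa_rels E)"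

section \<open>Algebraic branching systems and their induced representations\<close>

locale algebraic_branching_system =
  fixes E :: "('v, 'e) pre_digraph"
    and X :: "'x set"
    and R :: "'e \<Rightarrow> 'x set"
    and D :: "'v \<Rightarrow> 'x set"
    and f :: "'e \<Rightarrow> 'x \<Rightarrow> 'x"
  assumes R_subset: "e \<in> arcs E \<Longrightarrow> R e \<subseteq> X"
    and D_subset: "v \<in> verts E \<Longrightarrow> D v \<subseteq> X"
    and R_disjoint: "\<lbrakk>e \<in> arcs E; d \<in> arcs E; d \<noteq> e\<rbrakk> \<Longrightarrow> R e \<inter> R d = {}"
    and D_disjoint: "\<lbrakk>u \<in> verts E; v \<in> verts E; u \<noteq> v\<rbrakk> \<Longrightarrow> D u \<inter> D v = {}"
    and R_subset_D: "e \<in> arcs E \<Longrightarrow> R e \<subseteq> D (tail E e)"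
    and D_eq_Union: "\<lbrakk>v \<in> verts E; finite (out_arcs E v); out_arcs E v \<noteq> {}\<rbrakk> \<Longrightarrow>
          D v = (\<Union>e\<in>out_arcs E v. R e)"
    and f_bij: "e \<in> arcs E \<Longrightarrow> bij_betw (f e) (D (head E e)) (R e)"

text \<open>
  \<open>Hom_algebra X\<close> is the algebra of all linear endomaps of the space of functions on \<open>X\<close>. Both
  layers are extensional (\<open>undefined\<close> off \<open>X\<close>, resp. off \<open>fun_module X\<close>), so that HOL equality of
  operators is equality of maps on \<open>fun_module X\<close>.
\<close>

definition fun_module :: "'x set \<Rightarrow> ('x \<Rightarrow> 'k) set" where
  "fun_module X = X \<rightarrow>\<^sub>E UNIV"

definition fun_add :: "'x set \<Rightarrow> ('x \<Rightarrow> 'k :: field) \<Rightarrow> ('x \<Rightarrow> 'k) \<Rightarrow> 'x \<Rightarrow> 'k" where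
  "fun_add X \<phi> \<psi> = (\<lambda>x\<in>X. \<phi> x + \<psi> x)"

definition fun_smul :: "'x set \<Rightarrow> 'k :: field \<Rightarrow> ('x \<Rightarrow> 'k) \<Rightarrow> 'x \<Rightarrow> 'k" where
  "fun_smul X c \<phi> = (\<lambda>x\<in>X. c * \<phi> x)"

definition Hom_algebra ::
  "'x set \<Rightarrow> ('k :: field, ('x \<Rightarrow> 'k) \<Rightarrow> ('x \<Rightarrow> 'k)) k_algebra" where
  "Hom_algebra X =
     \<lparr> carrier = {T \<in> fun_module X \<rightarrow>\<^sub>E fun_module X.
         (\<forall>\<phi>\<in>fun_module X. \<forall>\<psi>\<in>fun_module X. T (fun_add X \<phi> \<psi>) = fun_add X (T \<phi>) (T \<psi>)) \<and>
         (\<forall>c. \<forall>\<phi>\<in>fun_module X. T (fun_smul X c \<phi>) = fun_smul X c (T \<phi>))},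
       zero = (\<lambda>\<phi>\<in>fun_module X. \<lambda>x\<in>X. 0),
       add = (\<lambda>S T. \<lambda>\<phi>\<in>fun_module X. fun_add X (S \<phi>) (T \<phi>)),
       smul = (\<lambda>c T. \<lambda>\<phi>\<in>fun_module X. fun_smul X c (T \<phi>)),
       mul = (\<lambda>S T. \<lambda>\<phi>\<in>fun_module X. S (T \<phi>)) \<rparr>"

fun rep_gen ::
  "('v, 'e) pre_digraph \<Rightarrow> 'x set \<Rightarrow> ('e \<Rightarrow> 'x set) \<Rightarrow> ('v \<Rightarrow> 'x set) \<Rightarrow> ('e \<Rightarrow> 'x \<Rightarrow> 'x) \<Rightarrow>
   ('v, 'e) lpa_gen \<Rightarrow> ('x \<Rightarrow> 'k :: field) \<Rightarrow> ('x \<Rightarrow> 'k)" where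
  "rep_gen E X R D f (Edge e) =
     (\<lambda>\<phi>\<in>fun_module X. \<lambda>x\<in>X. if x \<in> R e then \<phi> (inv_into (D (head E e)) (f e) x) else 0)"
| "rep_gen E X R D f (Ghost e) =
     (\<lambda>\<phi>\<in>fun_module X. \<lambda>x\<in>X. if x \<in> D (head E e) then \<phi> (f e x) else 0)"
| "rep_gen E X R D f (Vertex v) =
     (\<lambda>\<phi>\<in>fun_module X. \<lambda>x\<in>X. if x \<in> D v then \<phi> x else 0)"

definition induced_rep ::
  "('v, 'e) pre_digraph \<Rightarrow> 'x set \<Rightarrow> ('e \<Rightarrow> 'x set) \<Rightarrow> ('v \<Rightarrow> 'x set) \<Rightarrow> ('e \<Rightarrow> 'x \<Rightarrow> 'x) \<Rightarrow>
   (('v, 'e) lpa_gen, 'k :: field) alg_term set \<Rightarrow> ('x \<Rightarrow> 'k) \<Rightarrow> ('x \<Rightarrow> 'k)" where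
  "induced_rep E X R D f = presented_lift (Hom_algebra X) (rep_gen E X R D f)"

lemma fun_module_eqI:
  "\<lbrakk>\<phi> \<in> fun_module X; \<psi> \<in> fun_module X; \<And>x. x \<in> X \<Longrightarrow> \<phi> x = \<psi> x\<rbrakk> \<Longrightarrow> \<phi> = \<psi>"
  unfolding fun_module_def by (rule PiE_ext)

lemma fun_module_restrict [simp]: "(\<lambda>x\<in>X. h x) \<in> fun_module X"
  by (simp add: fun_module_def)

lemma fun_module_closed [simp]:
  "fun_add X \<phi> \<psi> \<in> fun_module X" "fun_smul X c \<phi> \<in> fun_module X"
  by (simp_all add: fun_add_def fun_smul_def)

lemma fun_apply [simp]:
  "x \<in> X \<Longrightarrow> fun_add X \<phi> \<psi> x = \<phi> x + \<psi> x"
  "x \<in> X \<Longrightarrow> fun_smul X c \<phi> x = c * \<phi> x"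
  by (simp_all add: fun_add_def fun_smul_def)

lemma Hom_eqI:
  assumes "S \<in> carrier (Hom_algebra X)" "T \<in> carrier (Hom_algebra X)"
    and "\<And>\<phi> x. \<lbrakk>\<phi> \<in> fun_module X; x \<in> X\<rbrakk> \<Longrightarrow> S \<phi> x = T \<phi> x"
  shows "S = T"
proof (rule PiE_ext[of S "fun_module X" "\<lambda>_. fun_module X" T])
  show "S \<in> fun_module X \<rightarrow>\<^sub>E fun_module X" "T \<in> fun_module X \<rightarrow>\<^sub>E fun_module X"
    using assms(1,2) by (simp_all add: Hom_algebra_def)
  then show "S \<phi> = T \<phi>" if "\<phi> \<in> fun_module X" for \<phi>
    using that assms(3) by (intro fun_module_eqI[of _ X]) (auto simp: PiE_def Pi_def)
qed

lemma Hom_carrierI: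
  assumes "\<And>\<phi>. \<phi> \<in> fun_module X \<Longrightarrow> T \<phi> \<in> fun_module X"
    and "\<And>\<phi>. \<phi> \<notin> fun_module X \<Longrightarrow> T \<phi> = undefined"
    and "\<And>\<phi> \<psi> x. \<lbrakk>\<phi> \<in> fun_module X; \<psi> \<in> fun_module X; x \<in> X\<rbrakk> \<Longrightarrow>
      T (fun_add X \<phi> \<psi>) x = T \<phi> x + T \<psi> x"
    and "\<And>c \<phi> x. \<lbrakk>\<phi> \<in> fun_module X; x \<in> X\<rbrakk> \<Longrightarrow> T (fun_smul X c \<phi>) x = c * T \<phi> x"
  shows "T \<in> carrier (Hom_algebra X)"
  unfolding Hom_algebra_def
  using assms by (auto simp: PiE_def Pi_def extensional_def intro!: fun_module_eqI[of _ X])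

lemma Hom_apply:
  assumes "T \<in> carrier (Hom_algebra X)"
  shows "\<phi> \<in> fun_module X \<Longrightarrow> T \<phi> \<in> fun_module X"
    and "\<lbrakk>\<phi> \<in> fun_module X; \<psi> \<in> fun_module X\<rbrakk> \<Longrightarrow>
      T (fun_add X \<phi> \<psi>) = fun_add X (T \<phi>) (T \<psi>)"
    and "\<phi> \<in> fun_module X \<Longrightarrow> T (fun_smul X c \<phi>) = fun_smul X c (T \<phi>)"
  using assms by (auto simp: Hom_algebra_def)

lemma Hom_ops:
  "zero (Hom_algebra X) = (\<lambda>\<phi>\<in>fun_module X. \<lambda>x\<in>X. 0)"
  "add (Hom_algebra X) S T = (\<lambda>\<phi>\<in>fun_module X. fun_add X (S \<phi>) (T \<phi>))"
  "smul (Hom_algebra X) c T = (\<lambda>\<phi>\<in>fun_module X. fun_smul X c (T \<phi>))"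
  "mul (Hom_algebra X) S T = (\<lambda>\<phi>\<in>fun_module X. S (T \<phi>))"
  by (simp_all add: Hom_algebra_def)

lemma Hom_closed:
  "zero (Hom_algebra X) \<in> carrier (Hom_algebra X)"
  "\<lbrakk>S \<in> carrier (Hom_algebra X); T \<in> carrier (Hom_algebra X)\<rbrakk> \<Longrightarrow>
     add (Hom_algebra X) S T \<in> carrier (Hom_algebra X)"
  "T \<in> carrier (Hom_algebra X) \<Longrightarrow> smul (Hom_algebra X) c T \<in> carrier (Hom_algebra X)"
  "\<lbrakk>S \<in> carrier (Hom_algebra X); T \<in> carrier (Hom_algebra X)\<rbrakk> \<Longrightarrow>
     mul (Hom_algebra X) S T \<in> carrier (Hom_algebra X)"
  by (rule Hom_carrierI; simp add: Hom_ops Hom_apply algebra_simps)+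

lemma k_algebra_Hom: "k_algebra (Hom_algebra X)"
  by unfold_locales
    (((simp add: Hom_closed)?;
      rule Hom_eqI[of _ X]; (simp add: Hom_closed)?; simp add: Hom_ops Hom_apply algebra_simps)+)

lemma (in algebraic_branching_system) rep_gen_closed:
  assumes "wf_digraph E" "x \<in> lpa_gens E"
  shows "rep_gen E X R D f x \<in> carrier (Hom_algebra X)"
proof -
  have "inv_into (D (head E e)) (f e) x \<in> X" if "e \<in> arcs E" "x \<in> R e" for e x
    using that D_subset[OF wf_digraph.head_in_verts[OF assms(1)]]
      inv_into_into[of x "f e" "D (head E e)"] f_bij by (fastforce simp: bij_betw_def)
  moreover have "f e x \<in> X" if "e \<in> arcs E" "x \<in> D (head E e)" for e x
    using that R_subset f_bij by (fastforce simp: bij_betw_def)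
  ultimately show ?thesis
    using assms(2) by (auto simp: lpa_gens_def intro!: Hom_carrierI)
qed

lemma (in algebraic_branching_system) rep_gen_rels:
  assumes E: "wf_digraph E"
    and ab: "(a, b) \<in> lpa_rels E"
  shows "eval_term (Hom_algebra X) (rep_gen E X R D f) a =
    eval_term (Hom_algebra X) (rep_gen E X R D f) b"
proof -
  let ?ev = "eval_term (Hom_algebra X) (rep_gen E X R D f)"
  interpret wf_digraph E by (rule E)
  note gen = rep_gen_closed[OF E]
  have inv: "inv_into (D (head E e)) (f e) x \<in> D (head E e)"
    "f e (inv_into (D (head E e)) (f e) x) = x" if "e \<in> arcs E" "x \<in> R e" for e x
    using that f_bij[of e] by (auto simp: bij_betw_def inv_into_into f_inv_into_f)
  have fR: "f e x \<in> R e" "inv_into (D (head E e)) (f e) (f e x) = x"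
    if "e \<in> arcs E" "x \<in> D (head E e)" for e x
    using that f_bij[of e] by (auto simp: bij_betw_def)
  have RD: "x \<in> D (tail E e)" if "e \<in> arcs E" "x \<in> R e" for e x
    using that R_subset_D by blast
  have inX: "inv_into (D (head E e)) (f e) x \<in> X" if "e \<in> arcs E" "x \<in> R e" for e x
    using inv(1)[OF that] D_subset that(1) head_in_verts by blast
  have fX: "f e x \<in> X" if "e \<in> arcs E" "x \<in> D (head E e)" for e x
    using fR(1)[OF that] R_subset that(1) by blast
  have rels_terms: "a \<in> alg_terms (lpa_gens E) \<and> b \<in> alg_terms (lpa_gens E)"
    using ab
  proof cases
    case (CK2 v es)
    have "foldr Add (map (\<lambda>e. Mul (Gen (Edge e)) (Gen (Ghost e))) es) Zero
        \<in> (alg_terms (lpa_gens E) :: (_, 'k) alg_term set)" if "set es \<subseteq> arcs E" for es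
      using that by (induction es) (auto simp: lpa_gens_def)
    with CK2 show ?thesis by (auto simp: lpa_gens_def out_arcs_def)
  qed (auto simp: lpa_gens_def)
  have "?ev a \<phi> x = ?ev b \<phi> x" if \<phi>: "\<phi> \<in> fun_module X" and x: "x \<in> X" for \<phi> x
    using ab
  proof cases
    case (orth v w)
    with D_disjoint[of v w] \<phi> x show ?thesis by (auto simp: Hom_ops)
  next
    case (CK1_diff e d)
    with R_disjoint[of e d] fR fX \<phi> x show ?thesis by (fastforce simp: Hom_ops)
  next
    case (CK2 v es)
    have sum: "?ev (foldr Add (map (\<lambda>e. Mul (Gen (Edge e)) (Gen (Ghost e))) es) Zero) \<phi> x =
        (if \<exists>e\<in>set es. x \<in> R e then \<phi> x else 0)"
      if "distinct es" "set es \<subseteq> arcs E" for es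
      using that
    proof (induction es)
      case Nil
      then show ?case using \<phi> x by (simp add: Hom_ops)
    next
      case (Cons e es)
      then have "\<not> (\<exists>d\<in>set es. x \<in> R d)" if "x \<in> R e"
        using that R_disjoint[of e] by fastforce
      with Cons show ?case using \<phi> x inv inX by (auto simp: Hom_ops)
    qed
    from CK2 have "finite (out_arcs E v)" "out_arcs E v \<noteq> {}"
      by (metis List.finite_set, metis set_empty)
    with CK2 D_eq_Union[of v] have "D v = (\<Union>e\<in>set es. R e)" by simp
    with CK2 sum[of es] \<phi> x show ?thesis by (auto simp: out_arcs_def)
  qed (use \<phi> x inv fR RD inX fX in \<open>auto simp: Hom_ops\<close>)
  with rels_terms show ?thesis
    by (intro Hom_eqI[of _ X] eval_term_closed[OF k_algebra_Hom gen]) auto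
qed

theorem (in algebraic_branching_system) induced_rep_hom:
  assumes "wf_digraph E"
  shows "alg_hom (leavitt_path_algebra E) (Hom_algebra X) (induced_rep E X R D f)"
    and "x \<in> lpa_gens E \<Longrightarrow>
      induced_rep E X R D f (pres_cong (lpa_gens E) (lpa_rels E) `` {Gen x}) = rep_gen E X R D f x"
  unfolding leavitt_path_algebra_def induced_rep_def
  using presented_algebra_universal(1,2)[OF k_algebra_Hom rep_gen_closed[OF assms]
      rep_gen_rels[OF assms]]
  by blast+

section \<open>Closed paths\<close>

definition closed_paths :: "('v, 'e) pre_digraph \<Rightarrow> 'v \<Rightarrow> 'e list set" where
  "closed_paths E v = {\<alpha>. \<alpha> \<noteq> [] \<and> pre_digraph.awalk E v \<alpha> v}"

definition path_map :: "('e \<Rightarrow> 'x \<Rightarrow> 'x) \<Rightarrow> 'e list \<Rightarrow> 'x \<Rightarrow> 'x" where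
  "path_map f \<alpha> = foldr (\<circ>) (map f \<alpha>) id"

end

theory Submission
  imports Defs
begin

text \<open>
  Let \<open>d\<close> be in the kernel. Since there are no sinks and the graph is row-finite, relation (4) shows that
  \<open>d = 0\<close> as soon as \<open>d q = 0\<close> for all paths \<open>q\<close> of some fixed length \<open>N\<close>; for \<open>N\<close> large, \<open>d q\<close> is
  a linear combination of paths ending at \<open>r(q)\<close>, without ghost edges. So it suffices that a
  combination \<open>y\<close> of distinct paths ending at \<open>v\<close> with \<open>\<pi>(y) = 0\<close> has zero coefficients. If \<open>p\<close> is
  a shortest path in \<open>y\<close>, the hypothesis yields \<open>z\<^sub>0 \<in> D\<^sub>v\<close> with \<open>f\<^sub>\<beta>(z\<^sub>0) \<noteq> z\<^sub>0\<close> for every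
  \<open>\<beta> \<noteq> []\<close> such that \<open>p\<beta>\<close> occurs in \<open>y\<close>. Then \<open>f\<^sub>q(z\<^sub>0) \<noteq> f\<^sub>p(z\<^sub>0)\<close> for all other paths \<open>q\<close> in \<open>y\<close>,
  so evaluating \<open>\<pi>(y)\<close> on the indicator function of \<open>z\<^sub>0\<close> at the point \<open>f\<^sub>p(z\<^sub>0)\<close> gives the
  coefficient of \<open>p\<close>.
\<close>

section \<open>Linear spans\<close>

context k_algebra
begin

section \<open>Consequences of the algebra axioms\<close>

lemmas closed [simp] = zero_closed add_closed smul_closed mul_closed

lemma zero_add [simp]: "a \<in> carrier A \<Longrightarrow> add A (zero A) a = a"
  by (metis add_comm add_zero zero_closed)

lemma smul_zero_left [simp]:
  assumes "a \<in> carrier A"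
  shows "smul A 0 a = zero A"
proof -
  have "smul A 0 a = add A (smul A 1 a) (smul A (- 1) a)"
    using add_smul[OF assms, of 1 "- 1"] by simp
  then show ?thesis using assms by (simp add: smul_one add_inverse)
qed

lemma smul_zero [simp]: "smul A c (zero A) = zero A"
  using smul_smul[of "zero A" c 0] by simp

lemma mul_zero [simp]: "a \<in> carrier A \<Longrightarrow> mul A a (zero A) = zero A"
  using mul_smul[of a "zero A" 0] by simp

lemma zero_mul [simp]: "a \<in> carrier A \<Longrightarrow> mul A (zero A) a = zero A"
  using smul_mul[of "zero A" a 0] by simp

lemma eq_if_diff_zero:
  assumes "a \<in> carrier A" "b \<in> carrier A" "add A a (smul A (- 1) b) = zero A"
  shows "a = b"
proof -
  have "add A (smul A (- 1) b) b = zero A"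
    using assms by (simp add: add_comm[of _ b] add_inverse)
  then have "a = add A (add A a (smul A (- 1) b)) b"
    using assms(1,2) by (simp add: add_assoc add_zero)
  with assms show ?thesis by simp
qed

text \<open>Linear combinations are built one scaled summand at a time, so that facts about them
  follow by rule induction. An element of \<open>S\<close> may be used repeatedly.\<close>

inductive_set lspan :: "'a set \<Rightarrow> 'a set" for S where
  zero: "zero A \<in> lspan S"
| step: "\<lbrakk>s \<in> S; y \<in> lspan S\<rbrakk> \<Longrightarrow> add A (smul A c s) y \<in> lspan S"

lemma lspan_carrier: "\<lbrakk>y \<in> lspan S; S \<subseteq> carrier A\<rbrakk> \<Longrightarrow> y \<in> carrier A"
  by (induction rule: lspan.induct) auto

lemma lspan_mono: "\<lbrakk>y \<in> lspan S; S \<subseteq> T\<rbrakk> \<Longrightarrow> y \<in> lspan T"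
  by (induction rule: lspan.induct) (auto intro: lspan.intros)

lemma lspan_base: "\<lbrakk>s \<in> S; S \<subseteq> carrier A\<rbrakk> \<Longrightarrow> s \<in> lspan S"
  using lspan.step[OF _ lspan.zero, of s S 1] by (auto simp: smul_one add_zero subset_iff)

lemma lspan_add: "\<lbrakk>y \<in> lspan S; z \<in> lspan S; S \<subseteq> carrier A\<rbrakk> \<Longrightarrow> add A y z \<in> lspan S"
  by (induction rule: lspan.induct)
    (auto simp: lspan_carrier add_assoc subset_iff intro: lspan.intros)

lemma lspan_smul: "\<lbrakk>y \<in> lspan S; S \<subseteq> carrier A\<rbrakk> \<Longrightarrow> smul A c y \<in> lspan S"
  by (induction rule: lspan.induct)
    (auto simp: lspan_carrier smul_add smul_smul subset_iff intro: lspan.intros)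

lemma lspan_mul:
  assumes "y \<in> lspan S" "a \<in> carrier A" "S \<subseteq> carrier A" "T \<subseteq> carrier A"
    and "\<And>s. s \<in> S \<Longrightarrow> mul A a s \<in> lspan T"
  shows "mul A a y \<in> lspan T"
  using assms(1)
proof (induction rule: lspan.induct)
  case (step s y c)
  then have "add A (smul A c (mul A a s)) (mul A a y) \<in> lspan T"
    using assms(4,5) by (intro lspan_add lspan_smul) auto
  moreover have "s \<in> carrier A" "y \<in> carrier A"
    using step.hyps assms(3) lspan_carrier by blast+
  ultimately show ?case using assms(2) by (simp add: mul_add mul_smul)
qed (use assms(2) in \<open>auto intro: lspan.zero\<close>)

text \<open>A derivation uses only finitely many generators. This cuts the possibly infinite set of
  paths ending at a vertex down to a finite one, as the hypothesis on closed paths requires.\<close>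

lemma lspan_finite_subset:
  "y \<in> lspan S \<Longrightarrow> \<exists>T. finite T \<and> T \<subseteq> S \<and> y \<in> lspan T"
proof (induction rule: lspan.induct)
  case (step s y c)
  then obtain T where "finite T" "T \<subseteq> S" "y \<in> lspan T" by blast
  with step.hyps(1) show ?case
    by (intro exI[of _ "insert s T"]) (auto intro: lspan.step lspan_mono)
qed (auto intro: lspan.zero)

text \<open>All occurrences of \<open>s\<close> are gathered into a single coefficient. This later
  isolates the coefficient of a shortest path.\<close>

lemma lspan_insertE:
  assumes "y \<in> lspan (insert s S)" "s \<in> carrier A" "S \<subseteq> carrier A"
  obtains c z where "z \<in> lspan S" "y = add A (smul A c s) z"
proof -
  have "\<exists>c. \<exists>z\<in>lspan S. y = add A (smul A c s) z"
    using assms(1)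
  proof (induction rule: lspan.induct)
    case zero
    show ?case
      using assms(2) by (intro exI[of _ 0] bexI[of _ "zero A"]) (auto simp: lspan.zero)
  next
    case (step t y b)
    then obtain c z where z: "z \<in> lspan S" "y = add A (smul A c s) z" by blast
    have zc: "z \<in> carrier A" by (rule lspan_carrier[OF z(1) assms(3)])
    show ?case
    proof (cases "t = s")
      case True
      with z zc assms(2) have "add A (smul A b t) y = add A (smul A (b + c) s) z"
        by (simp add: add_smul add_assoc)
      with z(1) show ?thesis by blast
    next
      case False
      with step.hyps have t: "t \<in> S" by simp
      with assms(3) have tc: "t \<in> carrier A" by blast
      have "add A (smul A b t) y = add A (add A (smul A b t) (smul A c s)) z"
        using z zc tc assms(2) by (simp add: add_assoc)
      also have "\<dots> = add A (add A (smul A c s) (smul A b t)) z"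
        using tc assms(2) by (simp add: add_comm)
      also have "\<dots> = add A (smul A c s) (add A (smul A b t) z)"
        using zc tc assms(2) by (simp add: add_assoc)
      finally show ?thesis using lspan.step[OF t z(1)] by blast
    qed
  qed
  then show ?thesis using that by blast
qed

lemma foldr_add_closed [simp]:
  "(\<And>x. x \<in> set xs \<Longrightarrow> F x \<in> carrier A) \<Longrightarrow> foldr (add A) (map F xs) (zero A) \<in> carrier A"
  by (induction xs) auto

lemma mul_foldr_add_eq_zero:
  assumes "a \<in> carrier A" "\<And>x. x \<in> set xs \<Longrightarrow> F x \<in> carrier A"
    and "\<And>x. x \<in> set xs \<Longrightarrow> mul A a (F x) = zero A"
  shows "mul A a (foldr (add A) (map F xs) (zero A)) = zero A"
  using assms by (induction xs) (auto simp: mul_add)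

end

lemma eval_term_foldr_Add:
  "eval_term A g (foldr Add ts Zero) = foldr (add A) (map (eval_term A g) ts) (zero A)"
  by (induction ts) auto

section \<open>Leavitt families\<close>

text \<open>Any algebra with elements satisfying the Leavitt relations is allowed, which keeps
  equivalence classes out of the computations. The presented algebra is an instance, and there
  \<open>ev\<close> is the quotient map on terms.\<close>

locale leavitt_family = wf_digraph E + k_algebra A
  for E :: "('v, 'e) pre_digraph" and A :: "('k :: field, 'a) k_algebra" +
  fixes g :: "('v, 'e) lpa_gen \<Rightarrow> 'a"
  assumes gen_closed: "x \<in> lpa_gens E \<Longrightarrow> g x \<in> carrier A"
    and gen_rels: "(s, t) \<in> lpa_rels E \<Longrightarrow> eval_term A g s = eval_term A g t"
begin

abbreviation ev :: "(('v, 'e) lpa_gen, 'k) alg_term \<Rightarrow> 'a" where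
  "ev \<equiv> eval_term A g"

lemma ev_closed: "t \<in> alg_terms (lpa_gens E) \<Longrightarrow> ev t \<in> carrier A"
  by (rule eval_term_closed[OF k_algebra_axioms gen_closed])

lemma gen_closed' [simp]:
  "v \<in> verts E \<Longrightarrow> g (Vertex v) \<in> carrier A"
  "e \<in> arcs E \<Longrightarrow> g (Edge e) \<in> carrier A"
  "e \<in> arcs E \<Longrightarrow> g (Ghost e) \<in> carrier A"
  by (auto intro: gen_closed simp: lpa_gens_def)

lemma gen_eqs:
  "v \<in> verts E \<Longrightarrow> mul A (g (Vertex v)) (g (Vertex v)) = g (Vertex v)"
  "\<lbrakk>v \<in> verts E; w \<in> verts E; v \<noteq> w\<rbrakk> \<Longrightarrow> mul A (g (Vertex v)) (g (Vertex w)) = zero A"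
  "e \<in> arcs E \<Longrightarrow> mul A (g (Vertex (tail E e))) (g (Edge e)) = g (Edge e)"
  "e \<in> arcs E \<Longrightarrow> mul A (g (Edge e)) (g (Vertex (head E e))) = g (Edge e)"
  "e \<in> arcs E \<Longrightarrow> mul A (g (Ghost e)) (g (Vertex (tail E e))) = g (Ghost e)"
  "e \<in> arcs E \<Longrightarrow> mul A (g (Ghost e)) (g (Edge e)) = g (Vertex (head E e))"
  "\<lbrakk>e \<in> arcs E; d \<in> arcs E; e \<noteq> d\<rbrakk> \<Longrightarrow> mul A (g (Ghost e)) (g (Edge d)) = zero A"
  using gen_rels[OF lpa_rels.idem] gen_rels[OF lpa_rels.orth] gen_rels[OF lpa_rels.source_edge]
    gen_rels[OF lpa_rels.edge_range] gen_rels[OF lpa_rels.ghost_source]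
    gen_rels[OF lpa_rels.CK1_same] gen_rels[OF lpa_rels.CK1_diff]
  by simp_all

lemma vertex_eq_sum:
  assumes "v \<in> verts E" "distinct es" "set es = out_arcs E v" "es \<noteq> []"
  shows "g (Vertex v) =
    foldr (add A) (map (\<lambda>e. mul A (g (Edge e)) (g (Ghost e))) es) (zero A)"
  using gen_rels[OF lpa_rels.CK2[OF assms]] by (simp add: eval_term_foldr_Add comp_def)

text \<open>The end vertex is an argument so that the empty path denotes a vertex.\<close>

fun path_elt :: "'v \<Rightarrow> 'e list \<Rightarrow> 'a" where
  "path_elt v [] = g (Vertex v)"
| "path_elt v (e # q) = mul A (g (Edge e)) (path_elt v q)"

lemma path_elt_closed [simp]: "awalk u q v \<Longrightarrow> path_elt v q \<in> carrier A"
  by (induction q arbitrary: u) (auto simp: awalk_simps)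

text \<open>The lower bound on the length matters for products: after the right factor has acted,
  the remaining paths must still be long enough for the left factor.\<close>

definition paths_to :: "'v \<Rightarrow> nat \<Rightarrow> 'e list set" where
  "paths_to v n = {q. (\<exists>u. awalk u q v) \<and> n \<le> length q}"

lemma paths_to_closed [simp]: "path_elt v ` paths_to v n \<subseteq> carrier A"
  by (auto simp: paths_to_def)

lemma paths_to_mono: "m \<le> n \<Longrightarrow> paths_to v n \<subseteq> paths_to v m"
  by (auto simp: paths_to_def)

lemma path_elt_in_lspan: "\<lbrakk>awalk u q v; n \<le> length q\<rbrakk> \<Longrightarrow> path_elt v q \<in> lspan (path_elt v ` paths_to v n)"
  by (rule lspan_base[OF imageI paths_to_closed]) (auto simp: paths_to_def)

lemma vertex_path_elt:
  assumes "w \<in> verts E" "awalk u q v"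
  shows "mul A (g (Vertex w)) (path_elt v q) = (if w = u then path_elt v q else zero A)"
proof (cases q)
  case Nil
  with assms show ?thesis by (auto simp: awalk_simps gen_eqs)
next
  case (Cons e r)
  with assms(2) have e: "e \<in> arcs E" "u = tail E e" "awalk (head E e) r v"
    by (auto simp: awalk_simps)
  have "mul A (g (Vertex w)) (g (Edge e)) = (if w = u then g (Edge e) else zero A)"
  proof (cases "w = u")
    case False
    \<comment> \<open>Relation (1) inserts the source vertex of \<open>e\<close>, which is
      orthogonal to \<open>w\<close>.\<close>
    have "mul A (g (Vertex w)) (g (Edge e)) =
        mul A (mul A (g (Vertex w)) (g (Vertex (tail E e)))) (g (Edge e))"
      using e assms(1) by (simp add: mul_assoc gen_eqs)
    with False e assms(1) show ?thesis by (simp add: gen_eqs)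
  qed (simp add: e gen_eqs)
  moreover have "mul A (g (Vertex w)) (path_elt v q) =
      mul A (mul A (g (Vertex w)) (g (Edge e))) (path_elt v r)"
    using e assms(1) Cons by (simp add: mul_assoc[symmetric])
  ultimately show ?thesis using e Cons by simp
qed

text \<open>A ghost edge either strips the first edge of a path or kills it, while vertices and
  edges never shorten a path. So \<open>N\<close> bounds the number of edges that \<open>t\<close>
  can strip: 1 for a ghost edge, 0 for the other generators, the maximum for a sum and the sum for a
  product.\<close>

lemma ev_path_elt_in_lspan:
  assumes "t \<in> alg_terms (lpa_gens E)"
  shows "\<exists>N. \<forall>u q v. awalk u q v \<and> N \<le> length q \<longrightarrow>
    mul A (ev t) (path_elt v q) \<in> lspan (path_elt v ` paths_to v (length q - N))"
  using assms
proof (induction t)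
  case (Gen x)
  show ?case
  proof (cases x)
    case (Vertex w)
    with Gen have w: "w \<in> verts E" by (auto simp: lpa_gens_def)
    show ?thesis
      by (intro exI[of _ 0])
        (auto simp: Vertex vertex_path_elt[OF w] intro: lspan.zero path_elt_in_lspan)
  next
    case (Edge e)
    with Gen have e: "e \<in> arcs E" by (auto simp: lpa_gens_def)
    show ?thesis
    proof (intro exI[of _ 0] allI impI)
      fix u q v assume q: "awalk u q v \<and> 0 \<le> length q"
      \<comment> \<open>Inserting the range of \<open>e\<close> decides whether \<open>e # q\<close>
        is a path or the product vanishes.\<close>
      have "mul A (g (Edge e)) (path_elt v q) =
          mul A (g (Edge e)) (mul A (g (Vertex (head E e))) (path_elt v q))"
        using e q by (simp add: mul_assoc[symmetric] gen_eqs path_elt_closed[of u])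
      also have "\<dots> = (if head E e = u then path_elt v (e # q) else zero A)"
        using e q vertex_path_elt[of "head E e" u q v] by simp
      also have "\<dots> \<in> lspan (path_elt v ` paths_to v (length q))"
      proof (cases "head E e = u")
        case True
        with e q have "awalk (tail E e) (e # q) v" by (simp add: awalk_Cons_iff)
        from path_elt_in_lspan[OF this, of "length q"] True show ?thesis by simp
      qed (simp add: lspan.zero)
      finally show "mul A (ev (Gen x)) (path_elt v q) \<in> lspan (path_elt v ` paths_to v (length q - 0))"
        by (simp add: Edge)
    qed
  next
    case (Ghost e)
    with Gen have e: "e \<in> arcs E" by (auto simp: lpa_gens_def)
    show ?thesis
    \<comment> \<open>Length at least 1 guarantees a first edge \<open>d\<close> for the ghost edge
      to meet.\<close>
    proof (intro exI[of _ 1] allI impI)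
      fix u q v assume q: "awalk u q v \<and> 1 \<le> length q"
      then obtain d r where r: "q = d # r" by (cases q) auto
      with q have d: "d \<in> arcs E" "awalk (head E d) r v" by (auto simp: awalk_simps)
      then have "mul A (g (Ghost e)) (path_elt v q) =
          mul A (mul A (g (Ghost e)) (g (Edge d))) (path_elt v r)"
        using e r by (simp add: mul_assoc)
      also have "\<dots> = (if e = d then path_elt v r else zero A)"
        using e d by (simp add: gen_eqs vertex_path_elt)
      finally show "mul A (ev (Gen x)) (path_elt v q) \<in> lspan (path_elt v ` paths_to v (length q - 1))"
        using d(2) by (auto simp: Ghost r intro: lspan.zero path_elt_in_lspan)
    qed
  qed
next
  case Zero
  show ?case
  proof (intro exI[of _ 0] allI impI)
    fix u q v assume "awalk u q v \<and> 0 \<le> length q"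
    then show "mul A (ev Zero) (path_elt v q) \<in> lspan (path_elt v ` paths_to v (length q - 0))"
      using path_elt_closed[of u q v] by (simp add: lspan.zero)
  qed
next
  case (Add s t)
  obtain M where
    M: "\<And>u q v. \<lbrakk>awalk u q v; M \<le> length q\<rbrakk> \<Longrightarrow>
      mul A (ev s) (path_elt v q) \<in> lspan (path_elt v ` paths_to v (length q - M))"
    using Add.IH(1) Add.prems by simp blast
  obtain N where
    N: "\<And>u q v. \<lbrakk>awalk u q v; N \<le> length q\<rbrakk> \<Longrightarrow>
      mul A (ev t) (path_elt v q) \<in> lspan (path_elt v ` paths_to v (length q - N))"
    using Add.IH(2) Add.prems by simp blast
  show ?case
  proof (intro exI[of _ "max M N"] allI impI)
    fix u q v assume q: "awalk u q v \<and> max M N \<le> length q"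
    have "mul A (ev s) (path_elt v q) \<in> lspan (path_elt v ` paths_to v (length q - max M N))"
      "mul A (ev t) (path_elt v q) \<in> lspan (path_elt v ` paths_to v (length q - max M N))"
      using q by (auto intro!: lspan_mono[OF M] lspan_mono[OF N] image_mono paths_to_mono)
    then show "mul A (ev (Add s t)) (path_elt v q) \<in> lspan (path_elt v ` paths_to v (length q - max M N))"
      using q Add.prems by (simp add: add_mul ev_closed path_elt_closed[of u] lspan_add)
  qed
next
  case (Scale c t)
  obtain N where
    N: "\<And>u q v. \<lbrakk>awalk u q v; N \<le> length q\<rbrakk> \<Longrightarrow>
      mul A (ev t) (path_elt v q) \<in> lspan (path_elt v ` paths_to v (length q - N))"
    using Scale.IH Scale.prems by simp blast
  show ?case
  proof (intro exI[of _ N] allI impI)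
    fix u q v assume "awalk u q v \<and> N \<le> length q"
    then show "mul A (ev (Scale c t)) (path_elt v q) \<in> lspan (path_elt v ` paths_to v (length q - N))"
      using Scale.prems lspan_smul[OF N paths_to_closed, of u q v]
      by (simp add: smul_mul ev_closed path_elt_closed[of u])
  qed
next
  case (Mul s t)
  obtain M where
    M: "\<And>u q v. \<lbrakk>awalk u q v; M \<le> length q\<rbrakk> \<Longrightarrow>
      mul A (ev s) (path_elt v q) \<in> lspan (path_elt v ` paths_to v (length q - M))"
    using Mul.IH(1) Mul.prems by simp blast
  obtain N where
    N: "\<And>u q v. \<lbrakk>awalk u q v; N \<le> length q\<rbrakk> \<Longrightarrow>
      mul A (ev t) (path_elt v q) \<in> lspan (path_elt v ` paths_to v (length q - N))"
    using Mul.IH(2) Mul.prems by simp blast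
  show ?case
  \<comment> \<open>Acting by \<open>t\<close> leaves paths of length at least
    \<open>length q - N\<close>, hence at least \<open>M\<close>, so the bound for \<open>s\<close>
    applies to each of them.\<close>
  proof (intro exI[of _ "M + N"] allI impI)
    fix u q v assume q: "awalk u q v \<and> M + N \<le> length q"
    have "mul A (ev s) (mul A (ev t) (path_elt v q))
        \<in> lspan (path_elt v ` paths_to v (length q - (M + N)))"
    proof (rule lspan_mul[OF N[of u]])
      fix y assume "y \<in> path_elt v ` paths_to v (length q - N)"
      then obtain r w where r: "y = path_elt v r" "awalk w r v" "length q - N \<le> length r"
        by (auto simp: paths_to_def)
      with q show "mul A (ev s) y \<in> lspan (path_elt v ` paths_to v (length q - (M + N)))"
        by (auto intro!: lspan_mono[OF M] image_mono paths_to_mono)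
    qed (use q Mul.prems in \<open>simp_all add: ev_closed\<close>)
    then show "mul A (ev (Mul s t)) (path_elt v q)
        \<in> lspan (path_elt v ` paths_to v (length q - (M + N)))"
      using q Mul.prems by (simp add: mul_assoc ev_closed path_elt_closed[of u])
  qed
qed

text \<open>Relation (4) expands \<open>u\<close> into its emitted edges; row-finiteness makes the
  sum finite and the absence of sinks makes it nonempty. The induction hypothesis, applied to
  \<open>a\<close> times an edge \<open>e\<close> at the range of \<open>e\<close>, shows that every
  such product vanishes.\<close>

lemma mul_vertex_eq_zero:
  assumes E: "row_finite E" "\<not> (\<exists>v. is_sink E v)"
    and "a \<in> carrier A" "u \<in> verts E"
    and "\<And>q v. \<lbrakk>awalk u q v; length q = n\<rbrakk> \<Longrightarrow> mul A a (path_elt v q) = zero A"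
  shows "mul A a (g (Vertex u)) = zero A"
  using assms(3-)
proof (induction n arbitrary: a u)
  case 0
  then show ?case using "0.prems"(3)[of "[]" u] by (simp add: awalk_simps)
next
  case (Suc n)
  obtain es where es: "set es = out_arcs E u" "distinct es"
    using E(1) Suc.prems(2) finite_distinct_list[of "out_arcs E u"] by (auto simp: row_finite_def)
  have "es \<noteq> []" using es E(2) Suc.prems(2) by (auto simp: is_sink_def)
  then have "g (Vertex u) =
      foldr (add A) (map (\<lambda>e. mul A (g (Edge e)) (g (Ghost e))) es) (zero A)"
    using es Suc.prems(2) by (intro vertex_eq_sum)
  moreover have "mul A a (mul A (g (Edge e)) (g (Ghost e))) = zero A" if "e \<in> set es" for e
  proof -
    from that es have e: "e \<in> arcs E" "tail E e = u" by (auto simp: out_arcs_def)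
    have "mul A (mul A a (g (Edge e))) (g (Vertex (head E e))) = zero A"
    proof (rule Suc.IH)
      fix q v assume q: "awalk (head E e) q v" "length q = n"
      with e Suc.prems(3)[of "e # q" v]
      have "mul A a (path_elt v (e # q)) = zero A" by (simp add: awalk_simps)
      with e q Suc.prems(1) show "mul A (mul A a (g (Edge e))) (path_elt v q) = zero A"
        by (simp add: mul_assoc path_elt_closed[of "head E e"])
    qed (use e Suc.prems in auto)
    with e Suc.prems(1) have "mul A a (g (Edge e)) = zero A"
      by (simp add: mul_assoc gen_eqs)
    with e Suc.prems(1) show ?thesis by (simp add: mul_assoc[symmetric])
  qed
  ultimately show ?case
    using Suc.prems(1) es by (auto simp: out_arcs_def intro!: mul_foldr_add_eq_zero)
qed

section \<open>Local units\<close>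

definition vertex_sum :: "'v list \<Rightarrow> 'a" where
  "vertex_sum vs = foldr (add A) (map (\<lambda>v. g (Vertex v)) vs) (zero A)"

lemma vertex_sum_closed [simp]: "set vs \<subseteq> verts E \<Longrightarrow> vertex_sum vs \<in> carrier A"
  unfolding vertex_sum_def by (rule foldr_add_closed) auto

lemma vertex_mul_vertex_sum:
  "\<lbrakk>w \<in> verts E; set vs \<subseteq> verts E; distinct vs\<rbrakk> \<Longrightarrow>
    mul A (g (Vertex w)) (vertex_sum vs) = (if w \<in> set vs then g (Vertex w) else zero A)"
proof (induction vs)
  case (Cons v vs)
  then have "mul A (g (Vertex w)) (vertex_sum (v # vs)) =
      add A (mul A (g (Vertex w)) (g (Vertex v))) (mul A (g (Vertex w)) (vertex_sum vs))"
    using vertex_sum_closed[of vs] by (simp add: vertex_sum_def mul_add)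
  with Cons show ?case by (cases "w = v") (auto simp: gen_eqs add_zero)
qed (simp add: vertex_sum_def)

lemma mul_vertex_sum_if_absorbs:
  assumes "a \<in> carrier A" "w \<in> verts E" "mul A a (g (Vertex w)) = a"
    and "w \<in> set vs" "set vs \<subseteq> verts E" "distinct vs"
  shows "mul A a (vertex_sum vs) = a"
proof -
  have "mul A a (vertex_sum vs) = mul A (mul A a (g (Vertex w))) (vertex_sum vs)"
    using assms(3) by simp
  also have "\<dots> = mul A a (mul A (g (Vertex w)) (vertex_sum vs))"
    using assms(1,2,5) by (intro mul_assoc) simp_all
  also have "\<dots> = a" using assms by (simp add: vertex_mul_vertex_sum)
  finally show ?thesis .
qed

text \<open>The algebra need not have a unit, but finite sums of distinct vertices act as right
  units on a given term. Allowing every list that contains \<open>F\<close> lets the sets of two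
  summands be united; for a product the set of the right factor suffices.\<close>

lemma local_right_unit:
  assumes "t \<in> alg_terms (lpa_gens E)"
  shows "\<exists>F. finite F \<and> F \<subseteq> verts E \<and>
    (\<forall>vs. F \<subseteq> set vs \<and> set vs \<subseteq> verts E \<and> distinct vs \<longrightarrow> mul A (ev t) (vertex_sum vs) = ev t)"
  using assms
proof (induction t)
  case (Gen x)
  then have "\<exists>w\<in>verts E. mul A (g x) (g (Vertex w)) = g x"
    by (auto simp: lpa_gens_def gen_eqs dest: gen_eqs intro: bexI[OF _ head_in_verts] bexI[OF _ tail_in_verts])
  then obtain w where w: "w \<in> verts E" "mul A (g x) (g (Vertex w)) = g x" by blast
  with Gen show ?case
    by (intro exI[of _ "{w}"]) (auto intro: mul_vertex_sum_if_absorbs[of _ w] gen_closed)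
next
  case (Add s t)
  then obtain F H where "finite F" "finite H" "F \<subseteq> verts E" "H \<subseteq> verts E"
    "\<forall>vs. F \<subseteq> set vs \<and> set vs \<subseteq> verts E \<and> distinct vs \<longrightarrow> mul A (ev s) (vertex_sum vs) = ev s"
    "\<forall>vs. H \<subseteq> set vs \<and> set vs \<subseteq> verts E \<and> distinct vs \<longrightarrow> mul A (ev t) (vertex_sum vs) = ev t"
    by auto
  with Add.prems show ?case
    by (intro exI[of _ "F \<union> H"]) (auto simp: add_mul ev_closed)
next
  case (Mul s t)
  then obtain F where "finite F" "F \<subseteq> verts E"
    "\<forall>vs. F \<subseteq> set vs \<and> set vs \<subseteq> verts E \<and> distinct vs \<longrightarrow> mul A (ev t) (vertex_sum vs) = ev t"
    by auto
  with Mul.prems show ?case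
    by (intro exI[of _ F]) (auto simp: mul_assoc ev_closed)
next
  case Zero
  show ?case by auto
next
  case (Scale c t)
  then show ?case by (auto simp: smul_mul ev_closed)
qed

text \<open>The element equals its product with a finite sum of vertices, and it annihilates each of
  these vertices.\<close>

lemma ev_eq_zero:
  assumes "row_finite E" "\<not> (\<exists>v. is_sink E v)" and t: "t \<in> alg_terms (lpa_gens E)"
    and z: "\<And>u q v. \<lbrakk>awalk u q v; length q = n\<rbrakk> \<Longrightarrow> mul A (ev t) (path_elt v q) = zero A"
  shows "ev t = zero A"
proof -
  have "mul A (ev t) (g (Vertex u)) = zero A" if "u \<in> verts E" for u
    by (rule mul_vertex_eq_zero[OF assms(1,2) ev_closed[OF t] that z])
  moreover obtain F where F: "finite F" "F \<subseteq> verts E"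
    "\<And>vs. \<lbrakk>F \<subseteq> set vs; set vs \<subseteq> verts E; distinct vs\<rbrakk> \<Longrightarrow> mul A (ev t) (vertex_sum vs) = ev t"
    using local_right_unit[OF t] by auto
  moreover obtain vs where "set vs = F" "distinct vs"
    using finite_distinct_list[OF F(1)] by blast
  ultimately show ?thesis
    using mul_foldr_add_eq_zero[OF ev_closed[OF t], of vs "\<lambda>v. g (Vertex v)"]
    by (auto simp: vertex_sum_def subset_iff)
qed

end

section \<open>The presented algebra as a Leavitt family\<close>

lemma lpa_rels_terms:
  assumes "wf_digraph E" "(a, b) \<in> lpa_rels E"
  shows "a \<in> alg_terms (lpa_gens E) \<and> b \<in> alg_terms (lpa_gens E)"
proof -
  interpret wf_digraph E by (rule assms(1))
  from assms(2) show ?thesis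
  proof cases
    case (CK2 v es)
    have "foldr Add (map (\<lambda>e. Mul (Gen (Edge e)) (Gen (Ghost e))) es) Zero
        \<in> (alg_terms (lpa_gens E) :: (_, 'c) alg_term set)" if "set es \<subseteq> arcs E" for es
      using that by (induction es) (auto simp: lpa_gens_def)
    with CK2 show ?thesis by (auto simp: lpa_gens_def out_arcs_def)
  qed (auto simp: lpa_gens_def)
qed

abbreviation lpa_class ::
  "('v, 'e) pre_digraph \<Rightarrow> (('v, 'e) lpa_gen, 'k :: field) alg_term \<Rightarrow> (('v, 'e) lpa_gen, 'k) alg_term set"
where "lpa_class E t \<equiv> pres_cong (lpa_gens E) (lpa_rels E) `` {t}"

text \<open>Evaluation at the classes of the generators is the quotient map, so every element of the
  Leavitt path algebra is a value of \<open>ev\<close>.\<close>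

lemma eval_term_lpa:
  "t \<in> alg_terms (lpa_gens E) \<Longrightarrow>
    eval_term (leavitt_path_algebra E) (\<lambda>x. lpa_class E (Gen x)) t = lpa_class E t"
  by (induction t)
    (simp_all add: leavitt_path_algebra_def add_class mul_class smul_class zero_class)

lemma leavitt_family_lpa:
  assumes "wf_digraph E"
  shows "leavitt_family E (leavitt_path_algebra E :: ('k :: field, _) k_algebra) (\<lambda>x. lpa_class E (Gen x))"
proof -
  interpret wf_digraph E by (rule assms)
  interpret k_algebra "leavitt_path_algebra E :: ('k :: field, _) k_algebra"
    unfolding leavitt_path_algebra_def by (rule k_algebra_presented)
  show ?thesis
  proof
    show "lpa_class E (Gen x) \<in> carrier (leavitt_path_algebra E)" if "x \<in> lpa_gens E" for x
      using that by (simp add: leavitt_path_algebra_def carrier_presentedI)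
    show "eval_term (leavitt_path_algebra E) (\<lambda>x. lpa_class E (Gen x)) s =
        eval_term (leavitt_path_algebra E) (\<lambda>x. lpa_class E (Gen x)) t"
      if "(s, t) \<in> lpa_rels E" for s t :: "(_, 'k) alg_term"
      using lpa_rels_terms[OF assms that] pres_cong_class_eq[OF pres_cong.rel[OF that]]
      by (simp add: eval_term_lpa)
  qed
qed

section \<open>Representations on branching systems\<close>

locale represented_leavitt_family =
  leavitt_family E A g + algebraic_branching_system E X R D f
  for E :: "('v, 'e) pre_digraph" and A :: "('k :: field, 'a) k_algebra" and g
    and X :: "'x set" and R D f +
  fixes h :: "'a \<Rightarrow> ('x \<Rightarrow> 'k) \<Rightarrow> ('x \<Rightarrow> 'k)"
  assumes hom: "alg_hom A (Hom_algebra X) h"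
    and hom_gen: "x \<in> lpa_gens E \<Longrightarrow> h (g x) = rep_gen E X R D f x"
begin

lemma hom_eqs:
  "\<lbrakk>a \<in> carrier A; b \<in> carrier A\<rbrakk> \<Longrightarrow> h (add A a b) = add (Hom_algebra X) (h a) (h b)"
  "a \<in> carrier A \<Longrightarrow> h (smul A c a) = smul (Hom_algebra X) c (h a)"
  "\<lbrakk>a \<in> carrier A; b \<in> carrier A\<rbrakk> \<Longrightarrow> h (mul A a b) = mul (Hom_algebra X) (h a) (h b)"
  "a \<in> carrier A \<Longrightarrow> h a \<in> carrier (Hom_algebra X)"
  using hom by (auto simp: alg_hom_def)

text \<open>Preservation of zero is not part of \<open>alg_hom\<close>; it follows from
  compatibility with the scalar 0.\<close>

lemma hom_zero: "h (zero A) = zero (Hom_algebra X)"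
  using hom_eqs(2)[of "zero A" 0] k_algebra.smul_zero_left[OF k_algebra_Hom hom_eqs(4)[OF zero_closed]]
  by simp

section \<open>Path maps on the points of \<open>X\<close>\<close>

lemma path_map_in_D:
  "\<lbrakk>awalk u q v; z \<in> D v\<rbrakk> \<Longrightarrow> path_map f q z \<in> D u"
proof (induction q arbitrary: u)
  case (Cons e q)
  then have "e \<in> arcs E" "u = tail E e" "path_map f q z \<in> D (head E e)"
    by (auto simp: awalk_simps)
  then have "f e (path_map f q z) \<in> R e" using f_bij[of e] by (auto simp: bij_betw_def)
  then show ?case using R_subset_D[OF \<open>e \<in> arcs E\<close>] \<open>u = tail E e\<close> by (auto simp: path_map_def)
qed (auto simp: path_map_def awalk_simps)

lemma path_map_Cons: "path_map f (e # q) z = f e (path_map f q z)"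
  by (simp add: path_map_def)

lemma path_map_Cons_in_R:
  "\<lbrakk>awalk u (e # q) v; z \<in> D v\<rbrakk> \<Longrightarrow> path_map f (e # q) z \<in> R e"
  using path_map_in_D[of "head E e" q v z] f_bij[of e]
  by (auto simp: awalk_simps path_map_Cons bij_betw_def)

text \<open>Ranges of distinct edges are disjoint, so the point \<open>f\<^sub>p(z)\<close> remembers the edges of \<open>p\<close>.\<close>

lemma path_map_eqD:
  assumes "awalk u p v" "awalk w q v" "z \<in> D v" "length p \<le> length q"
    and "path_map f p z = path_map f q z"
  shows "\<exists>r. q = p @ r \<and> awalk v r v \<and> path_map f r z = z"
  using assms
proof (induction p arbitrary: q u w)
  case Nil
  then have v: "u = v" "v \<in> verts E" by (auto simp: awalk_simps)
  have "w \<in> verts E" using Nil by (simp add: awalk_hd_in_verts)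
  moreover have "z \<in> D w" using path_map_in_D[OF Nil(2,3)] Nil(5) by (simp add: path_map_def)
  \<comment> \<open>The point \<open>z\<close> lies in both \<open>D v\<close> and
    \<open>D w\<close>, so \<open>q\<close> itself is the required path \<open>r\<close> from
    \<open>v\<close> to \<open>v\<close>.\<close>
  ultimately have "w = v" using D_disjoint[of w v] v Nil(3) by blast
  with Nil show ?case by (auto simp: path_map_def)
next
  case (Cons e p)
  then obtain d r where q: "q = d # r" by (cases q) auto
  note p = Cons.prems
  have ed: "e \<in> arcs E" "d \<in> arcs E" "awalk (head E e) p v" "awalk (head E d) r v"
    using p q by (auto simp: awalk_simps)
  have "path_map f q z \<in> R e \<inter> R d"
    using path_map_Cons_in_R[OF p(1,3)] path_map_Cons_in_R[of w d r v z] p q by simp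
  then have "d = e" using R_disjoint[OF ed(1,2)] by blast
  moreover have "path_map f p z \<in> D (head E e)" "path_map f r z \<in> D (head E d)"
    using ed p(3) path_map_in_D by blast+
  \<comment> \<open>With equal first edges, injectivity of \<open>f e\<close> on its domain cancels
    that edge.\<close>
  ultimately have "path_map f p z = path_map f r z"
    using p(5) q f_bij[OF ed(1)] by (auto simp: path_map_Cons bij_betw_def inj_on_def)
  with Cons.IH[OF ed(3,4)] p q \<open>d = e\<close> show ?case by auto
qed

section \<open>Point masses under the representation\<close>

definition point_mass :: "'x \<Rightarrow> 'x \<Rightarrow> 'k" where
  "point_mass z = (\<lambda>x\<in>X. if x = z then 1 else 0)"

lemma point_mass_fun_module [simp]: "point_mass z \<in> fun_module X"
  by (simp add: point_mass_def)

lemma point_mass_apply [simp]: "x \<in> X \<Longrightarrow> point_mass z x = (if x = z then 1 else 0)"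
  by (simp add: point_mass_def)

text \<open>An edge \<open>e\<close> moves a point mass along \<open>f e\<close>, since the inverse
  of \<open>f e\<close> takes \<open>x\<close> to the given point exactly when \<open>x\<close> is
  the image of that point. Iterating along \<open>q\<close> gives the claim.\<close>

lemma hom_path_elt_point_mass:
  assumes "awalk u q v" "z \<in> D v"
  shows "h (path_elt v q) (point_mass z) =
    point_mass (path_map f q z)"
  using assms(1)
proof (induction q arbitrary: u)
  case Nil
  then have "u \<in> verts E" "u = v" by (auto simp: awalk_simps)
  then show ?case
    using assms(2) Hom_apply(1)[OF hom_eqs(4)[OF path_elt_closed[OF Nil]] point_mass_fun_module]
    by (intro fun_module_eqI[of _ X]) (assumption | auto simp: hom_gen lpa_gens_def path_map_def)+
next
  case (Cons e q)
  then have e: "e \<in> arcs E" and q: "awalk (head E e) q v" by (auto simp: awalk_simps)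
  have pD: "path_map f q z \<in> D (head E e)" by (rule path_map_in_D[OF q assms(2)])
  have b: "bij_betw (f e) (D (head E e)) (R e)" by (rule f_bij[OF e])
  have inv: "inv_into (D (head E e)) (f e) x = path_map f q z \<longleftrightarrow> x = f e (path_map f q z)"
    if "x \<in> R e" for x
    using b pD that by (metis bij_betw_inv_into_left bij_betw_inv_into_right)
  have invX: "inv_into (D (head E e)) (f e) x \<in> X" if "x \<in> R e" for x
  proof -
    have "inv_into (D (head E e)) (f e) x \<in> D (head E e)"
      using b that by (auto simp: bij_betw_def inv_into_into)
    then show ?thesis using D_subset[OF head_in_verts[OF e]] by blast
  qed
  have "f e (path_map f q z) \<in> R e" using b pD by (auto simp: bij_betw_def)
  with e q invX inv show ?case
    using Hom_apply(1)[OF hom_eqs(4)[OF path_elt_closed[OF Cons.prems]] point_mass_fun_module]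
    by (intro fun_module_eqI[of _ X])
      (assumption | auto simp: hom_eqs path_elt_closed[of "head E e"] Hom_ops Cons.IH[OF q] hom_gen lpa_gens_def
        path_map_Cons)+
qed

lemma hom_point_mass_eq_zero:
  assumes "z \<in> D v" "\<And>q. q \<in> Q \<Longrightarrow> \<exists>u. awalk u q v" "x \<in> X"
    and "\<And>q. q \<in> Q \<Longrightarrow> path_map f q z \<noteq> x"
    and "y \<in> lspan (path_elt v ` Q)"
  shows "h y (point_mass z) x = 0"
  using assms(5)
proof (induction rule: lspan.induct)
  case zero
  show ?case using assms(3) by (simp add: hom_zero Hom_ops)
next
  case (step s y c)
  then obtain q u where q: "s = path_elt v q" "q \<in> Q" "awalk u q v" using assms(2) by blast
  moreover have "path_elt v ` Q \<subseteq> carrier A" using assms(2) path_elt_closed by blast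
  then have "y \<in> carrier A" using step.hyps lspan_carrier by blast
  ultimately show ?case
    using step.IH assms(3) assms(4)[OF q(2)] hom_path_elt_point_mass[OF q(3) assms(1)]
    by (auto simp: hom_eqs Hom_ops path_elt_closed[OF q(3)])
qed

text \<open>Induction on the number of paths: the coefficient of a shortest path is shown to vanish,
  so the same element \<open>y\<close> already lies in the span of the remaining paths.\<close>

lemma lspan_paths_eq_zero:
  assumes closed: "\<And>F. \<lbrakk>finite F; F \<subseteq> closed_paths E v\<rbrakk> \<Longrightarrow> \<exists>z\<in>D v. \<forall>\<alpha>\<in>F. path_map f \<alpha> z \<noteq> z"
    and "finite Q" "\<And>q. q \<in> Q \<Longrightarrow> \<exists>u. awalk u q v"
    and "y \<in> lspan (path_elt v ` Q)" "h y = zero (Hom_algebra X)"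
  shows "y = zero A"
  using assms(2-)
proof (induction "card Q" arbitrary: Q)
  case 0
  then have "y \<in> lspan {}" by simp
  then show ?case by cases auto
next
  case (Suc n)
  note Q = Suc.prems
  from Suc.hyps(2) have "Q \<noteq> {}" by auto
  \<comment> \<open>Minimal length is what \<open>path_map_eqD\<close> needs to present any
    colliding path as an extension of \<open>p\<close>.\<close>
  then obtain p where p: "p \<in> Q" "\<And>q. q \<in> Q \<Longrightarrow> length p \<le> length q"
    using arg_min_if_finite(1)[OF Q(1), of length] arg_min_least[OF Q(1), of _ length] by blast
  obtain w where w: "awalk w p v" using Q(2) p(1) by blast
  have cl: "path_elt v ` (Q - {p}) \<subseteq> carrier A" using Q(2) path_elt_closed by blast
  have "path_elt v ` Q = insert (path_elt v p) (path_elt v ` (Q - {p}))" using p(1) by auto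
  with Q(3) obtain c y' where y': "y' \<in> lspan (path_elt v ` (Q - {p}))"
    "y = add A (smul A c (path_elt v p)) y'"
    using lspan_insertE[OF _ path_elt_closed[OF w] cl, of y] by metis
  have y'c: "y' \<in> carrier A" by (rule lspan_carrier[OF y'(1) cl])
  \<comment> \<open>These are the closed paths to be avoided. The set is finite because prepending
    \<open>p\<close> is injective, and the empty extension, which is \<open>p\<close> itself, is
    excluded by \<open>closed_paths\<close>.\<close>
  let ?F = "{r. p @ r \<in> Q} \<inter> closed_paths E v"
  have "finite ((@) p -` Q)" by (rule finite_vimageI[OF Q(1)]) (auto simp: inj_def)
  then have "finite ?F" by (simp add: vimage_def)
  then obtain z where z: "z \<in> D v" "\<forall>\<alpha>\<in>?F. path_map f \<alpha> z \<noteq> z"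
    using closed[of ?F] by auto
  have ne: "path_map f q z \<noteq> path_map f p z" if "q \<in> Q - {p}" for q
  proof
    assume eq: "path_map f q z = path_map f p z"
    from that Q(2) obtain u where "awalk u q v" by blast
    with path_map_eqD[OF w _ z(1) _ eq[symmetric]] p(2) that
    obtain r where r: "q = p @ r" "awalk v r v" "path_map f r z = z" by blast
    with that have "r \<in> ?F" by (auto simp: closed_paths_def)
    with r(3) z(2) show False by blast
  qed
  have pX: "path_map f p z \<in> X"
    using path_map_in_D[OF w z(1)] D_subset awalk_hd_in_verts[OF w] by blast
  have "h y' (point_mass z) (path_map f p z) = 0"
    by (rule hom_point_mass_eq_zero[OF z(1) _ pX ne y'(1)]) (use Q(2) in auto)
  moreover have "h y (point_mass z) (path_map f p z) = 0"
    using Q(4) pX by (simp add: Hom_ops)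
  \<comment> \<open>At this point the summand of \<open>p\<close> contributes exactly
    \<open>c\<close>, while both \<open>h y\<close> and \<open>h y'\<close> give 0.\<close>
  ultimately have "c = 0"
    using pX by (simp add: y'(2) hom_eqs y'c path_elt_closed[OF w] Hom_ops hom_path_elt_point_mass[OF w z(1)])
  then have "y = y'" using y'(2) y'c w by (simp add: path_elt_closed[OF w])
  then show ?case
    using Suc.hyps(1)[of "Q - {p}"] Suc.hyps(2) Q p(1) y'(1) by (auto simp: card_Diff_singleton)
qed

lemma ev_kernel_trivial:
  assumes E: "row_finite E" "\<not> (\<exists>v. is_sink E v)"
    and closed: "\<And>v F. \<lbrakk>v \<in> verts E; finite F; F \<subseteq> closed_paths E v\<rbrakk> \<Longrightarrow>
      \<exists>z\<in>D v. \<forall>\<alpha>\<in>F. path_map f \<alpha> z \<noteq> z"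
    and t: "t \<in> alg_terms (lpa_gens E)" "h (ev t) = zero (Hom_algebra X)"
  shows "ev t = zero A"
proof -
  obtain N where N: "\<And>u q v. \<lbrakk>awalk u q v; N \<le> length q\<rbrakk> \<Longrightarrow>
      mul A (ev t) (path_elt v q) \<in> lspan (path_elt v ` paths_to v (length q - N))"
    using ev_path_elt_in_lspan[OF t(1)] by blast
  show ?thesis
  proof (rule ev_eq_zero[OF E t(1)])
    fix u q v assume q: "awalk u q v" "length q = N"
    \<comment> \<open>At length exactly \<open>N\<close> the lower bound drops to 0: all that
      matters is that no ghost edges remain.\<close>
    have "mul A (ev t) (path_elt v q) \<in> lspan (path_elt v ` paths_to v 0)"
      using N[OF q(1)] q(2) by simp
    then obtain T where T: "finite T" "T \<subseteq> path_elt v ` paths_to v 0"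
      "mul A (ev t) (path_elt v q) \<in> lspan T"
      using lspan_finite_subset by blast
    then obtain Q where Q: "finite Q" "Q \<subseteq> paths_to v 0" "T = path_elt v ` Q"
      by (meson finite_subset_image)
    show "mul A (ev t) (path_elt v q) = zero A"
    proof (rule lspan_paths_eq_zero[OF closed Q(1)])
      have "h (mul A (ev t) (path_elt v q)) = mul (Hom_algebra X) (zero (Hom_algebra X)) (h (path_elt v q))"
        using t q by (simp add: hom_eqs ev_closed path_elt_closed[of u])
      then show "h (mul A (ev t) (path_elt v q)) = zero (Hom_algebra X)"
        using k_algebra.zero_mul[OF k_algebra_Hom hom_eqs(4)[OF path_elt_closed[OF q(1)]]] by simp
    qed (use T Q q awalk_last_in_verts in \<open>auto simp: paths_to_def\<close>)
  qed
qed

end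

theorem theorem4p2:
  fixes E :: "('v, 'e) pre_digraph"
    and X :: "'x set"
    and R :: "'e \<Rightarrow> 'x set"
    and D :: "'v \<Rightarrow> 'x set"
    and f :: "'e \<Rightarrow> 'x \<Rightarrow> 'x"
  assumes "countable_digraph E"
    and "row_finite E"
    and "\<not> (\<exists>v. is_sink E v)"
    and "algebraic_branching_system E X R D f"
    and "\<forall>v\<in>verts E. \<forall>F. finite F \<and> F \<subseteq> closed_paths E v \<longrightarrow>
           (\<exists>z\<^sub>0\<in>D v. \<forall>\<alpha>\<in>F. path_map f \<alpha> z\<^sub>0 \<noteq> z\<^sub>0)"
  shows "inj_on (induced_rep E X R D f :: (('v, 'e) lpa_gen, 'k :: field) alg_term set \<Rightarrow> _)
           (carrier (leavitt_path_algebra E))"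
proof (rule inj_onI)
  let ?A = "leavitt_path_algebra E :: ('k, _) k_algebra"
  let ?h = "induced_rep E X R D f :: (('v, 'e) lpa_gen, 'k) alg_term set \<Rightarrow> _"
  let ?g = "\<lambda>x. lpa_class E (Gen x) :: (('v, 'e) lpa_gen, 'k) alg_term set"
  have wf: "wf_digraph E" using assms(1) by (simp add: countable_digraph_def)
  interpret abs: algebraic_branching_system E X R D f by (rule assms(4))
  \<comment> \<open>The family consists of the classes of the generators in the Leavitt path algebra
    itself.\<close>
  interpret represented_leavitt_family E ?A ?g X R D f ?h
    by (intro represented_leavitt_family.intro represented_leavitt_family_axioms.intro
        leavitt_family_lpa assms(4) wf abs.induced_rep_hom)
  fix a b
  assume ab: "a \<in> carrier ?A" "b \<in> carrier ?A" and eq: "?h a = ?h b"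
  obtain s t where st: "s \<in> alg_terms (lpa_gens E)" "a = lpa_class E s"
    "t \<in> alg_terms (lpa_gens E)" "b = lpa_class E t"
    using ab carrier_presentedE unfolding leavitt_path_algebra_def by metis
  \<comment> \<open>The kernel result concerns values of \<open>ev\<close>, so the difference of
    \<open>a\<close> and \<open>b\<close> is written as a term in representatives.\<close>
  let ?d = "Add s (Scale (- 1) t)"
  have d: "ev ?d = add ?A a (smul ?A (- 1) b)" using st by (simp add: eval_term_lpa)
  have hd: "?h (ev ?d) = zero (Hom_algebra X)"
    unfolding d using ab eq k_algebra.add_inverse[OF k_algebra_Hom hom_eqs(4)[OF ab(2)]]
    by (simp add: hom_eqs)
  have "ev ?d = zero ?A"
  proof (rule ev_kernel_trivial[OF assms(2,3) _ _ hd])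
    show "?d \<in> alg_terms (lpa_gens E)" using st by simp
    show "\<exists>z\<in>D v. \<forall>\<alpha>\<in>F. path_map f \<alpha> z \<noteq> z"
      if "v \<in> verts E" "finite F" "F \<subseteq> closed_paths E v" for v F
      using assms(5) that by blast
  qed
  then show "a = b" using d by (intro eq_if_diff_zero[OF ab]) (simp only:)
qed

end
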